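(* Let $\mathbb S=\{s\in\mathbb R^m: Cs\succeq_{\mathcal C} d\}$ and, for $s\in\mathbb S$, $\mathbb X(s)=\{x\in\mathbb R^n: Wx\succeq_{\mathcal K}Hs+h\}$, where $\mathcal C,\mathcal K$ are proper convex cones, and assume that $\Xi=\{(s,x): Cs\succeq_{\mathcal C} d,\ Wx\succeq_{\mathcal K}Hs+h\}$ admits a Slater point. Consider quadratic hypotheses $F_\theta(s,x)=\langle x,Q_{xx}x\rangle+\langle x,Q_{xs}s\rangle+\langle q,x\rangle$, $\theta=(Q_{xx},Q_{xs},q)\in\Theta\subseteq\mathbb R^{n\times n}\times\mathbb R^{n\times m}\times\mathbb R^n$, where $\Theta$ is one of the search spaces (a) $\{\theta: Q_{xx}\succeq\mathbb I\}$; (b) $\{\theta: Q_{xx}\succeq0,\ Q_{xs}=\mathbb I\}$; (c) $\{\theta: Q_{xx}\succeq0,\ \|\theta-\theta_0\|\le\Gamma\}$ for a given $\theta_0$, $\Gamma$ and a norm. Let $\ell_\theta(s,x)=F_\theta(s,x)-\min_{y\in\mathbb X(s)}F_\theta(s,y)$ be the suboptimality loss, let $\alpha\in(0,1]$, $\varepsilon\ge0$, and let $(\hat s_i,\hat x_i)\in\mathbb R^m\times\mathbb R^n$, $i\le N$, be training samples (not necessarily in $\Xi$) with empirical distribution $\hat{\mathbb P}_N$. Then the following conic program provides a safe approximation for the distributionally robust inverse optimization problem $\min_{\theta\in\Theta}\sup_{\mathbb Q\in\mathbb B^2_\varepsilon(\hat{\mathbb P}_N)}\mathrm{CVaR}^{\mathbb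 Q}_\alpha(\ell_\theta)$ over the $2$-Wasserstein ball: $$\begin{array}{lll}\text{minimize}&\displaystyle\tau+\frac1\alpha\Big(\varepsilon^2\lambda+\frac1N\sum_{i=1}^N r_i\Big)\\ \text{subject to}&\theta=(Q_{xx},Q_{xs},q)\in\Theta,\ \lambda\in\mathbb R_+,\ \tau,r_i,\rho_{i1},\rho_{i2}\in\mathbb R&\forall i\le N\\ &\phi_{i1},\phi_{i2}\in\mathcal C^*,\ \mu_{i1},\mu_{i2},\gamma_i\in\mathcal K^*,\ \chi_{i1},\chi_{i2}\in\mathbb R^m,\ \zeta_{i1},\eta_{i1},\zeta_{i2}\in\mathbb R^n&\forall i\le N\\ &\chi_{i1}=\frac12\big(-C^\top\phi_{i1}+H^\top(\mu_{i1}+\gamma_i)-2\lambda\hat s_i\big)&\forall i\le N\\ &\zeta_{i1}=\frac12(-q-W^\top\mu_{i1}-2\lambda\hat x_i),\quad\eta_{i1}=\frac12(q-W^\top\gamma_i)&\forall i\le N\\ &\rho_{i1}=\tau+r_i+\lambda(\langle\hat x_i,\hat x_i\rangle+\langle\hat s_i,\hat s_i\rangle)+\langle d,\phi_{i1}\rangle+\langle h,\mu_{i1}+\gamma_i\rangle&\forall i\le N\\ &\chi_{i2}=\frac12(-C^\top\phi_{i2}+H^\top\mu_{i2}-2\lambda\hat s_i),\quad \zeta_{i2}=\frac12(-W^\top\mu_{i2}-2\lambda\hat x_i)&\forall i\le N\\ &\rho_{i2}=r_i+\lambda(\langle\hat x_i,\hat x_i\rangle+\langle\hat s_i,\hat s_i\rangle)+\langle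 d,\phi_{i2}\rangle+\langle h,\mu_{i2}\rangle&\forall i\le N\\ &\begin{bmatrix}\lambda\mathbb I&-\frac12Q_{xs}^\top&\frac12Q_{xs}^\top&\chi_{i1}\\-\frac12Q_{xs}&\lambda\mathbb I-Q_{xx}&0&\zeta_{i1}\\ \frac12Q_{xs}&0&Q_{xx}&\eta_{i1}\\ \chi_{i1}^\top&\zeta_{i1}^\top&\eta_{i1}^\top&\rho_{i1}\end{bmatrix}\succeq0,\quad\begin{bmatrix}\lambda\mathbb I&0&\chi_{i2}\\0&\lambda\mathbb I&\zeta_{i2}\\ \chi_{i2}^\top&\zeta_{i2}^\top&\rho_{i2}\end{bmatrix}\succeq0&\forall i\le N.\end{array}$$
   Context: A proper convex cone is closed, solid and pointed; $s\succeq_{\mathcal C}t$ means $s-t\in\mathcal C$; $\mathcal C^*=\{t:\langle t,s\rangle\ge0\ \forall s\in\mathcal C\}$. For symmetric matrices, $Q\succeq R$ means $Q-R$ is positive semidefinite (so the matrix constraints on $Q_{xx}$ include its symmetry). $\mathbb I$ is the identity matrix; in search space (b) $m=n$. $\hat{\mathbb P}_N=\frac1N\sum_{i=1}^N\delta_{(\hat s_i,\hat x_i)}$. $\mathrm{CVaR}^{\mathbb Q}_\alpha(\ell)=\inf_{\tau\in\mathbb R}\ \tau+\frac1\alpha\mathbb E^{\mathbb Q}[\max\{\ell(s,x)-\tau,0\}]$. The signal-response space $\mathbb R^m\times\mathbb R^n$ carries the Euclidean norm $\|\cdot\|_2$. $\mathcal M^2(\Xi)$ is the set of probability distributions $\mathbb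 Q$ supported on $\Xi$ with $\mathbb E^{\mathbb Q}[\|\xi\|_2^2]<\infty$. The $2$-Wasserstein distance $W_2(\mathbb Q_1,\mathbb Q_2)$ is the infimum of $\left(\int\|\xi_1-\xi_2\|_2^2\,\Pi(d\xi_1,d\xi_2)\right)^{1/2}$ over joint distributions $\Pi$ with marginals $\mathbb Q_1,\mathbb Q_2$, and $\mathbb B^2_\varepsilon(\hat{\mathbb P}_N)=\{\mathbb Q\in\mathcal M^2(\Xi):W_2(\mathbb Q,\hat{\mathbb P}_N)\le\varepsilon\}$. "Safe approximation" means conservative: for each $\theta\in\Theta$, the infimum of the conic program over the remaining variables is an upper bound on the worst-case risk $\sup_{\mathbb Q\in\mathbb B^2_\varepsilon(\hat{\mathbb P}_N)}\mathrm{CVaR}^{\mathbb Q}_\alpha(\ell_\theta)$. *)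

theory Defs
  imports "HOL-Probability.Probability"
begin

definition proper_cone :: "'a::euclidean_space set \<Rightarrow> bool" where
  "proper_cone K \<longleftrightarrow>
     convex_cone K \<and> closed K \<and> interior K \<noteq> {} \<and> (\<forall>x. x \<in> K \<and> - x \<in> K \<longrightarrow> x = 0)"

definition cone_ge :: "'a::euclidean_space \<Rightarrow> 'a set \<Rightarrow> 'a \<Rightarrow> bool"
    ("(_ \<succeq>\<^bsub>_\<^esub> _)" [51, 0, 51] 50) where
  "s \<succeq>\<^bsub>K\<^esub> t \<longleftrightarrow> s - t \<in> K"

definition dual_cone :: "'a::euclidean_space set \<Rightarrow> 'a set" where
  "dual_cone K = {t. \<forall>s\<in>K. 0 \<le> t \<bullet> s}"

definition psd :: "real^'n^'n \<Rightarrow> bool" where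
  "psd A \<longleftrightarrow> transpose A = A \<and> (\<forall>v. 0 \<le> v \<bullet> (A *v v))"

definition is_norm :: "('a::real_vector \<Rightarrow> real) \<Rightarrow> bool" where
  "is_norm p \<longleftrightarrow>
     (\<forall>x. 0 \<le> p x) \<and> (\<forall>x. p x = 0 \<longleftrightarrow> x = 0) \<and>
     (\<forall>c x. p (c *\<^sub>R x) = \<bar>c\<bar> * p x) \<and> (\<forall>x y. p (x + y) \<le> p x + p y)"

text \<open>Block matrices are indexed by sum types: \<open>|||\<close> puts blocks side by side, \<open>===\<close> stacks them.\<close>

definition hcat :: "real^'a^'i \<Rightarrow> real^'b^'i \<Rightarrow> real^('a + 'b)^'i" (infixr "|||" 62) where
  "A ||| B = (\<chi> i j. case j of Inl a \<Rightarrow> A $ i $ a | Inr b \<Rightarrow> B $ i $ b)"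

definition vcat :: "real^'j^'a \<Rightarrow> real^'j^'b \<Rightarrow> real^'j^('a + 'b)" (infixr "===" 61) where
  "A === B = (\<chi> i. case i of Inl a \<Rightarrow> A $ a | Inr b \<Rightarrow> B $ b)"

text \<open>The empirical distribution \<open>(1 / N) * (\<Sum>i<N. \<delta>\<^sub>i)\<close>, where \<open>\<delta>\<^sub>i\<close> is the
  Dirac measure at \<open>\<xi> i\<close>.\<close>

definition empirical :: "nat \<Rightarrow> (nat \<Rightarrow> 'a::euclidean_space) \<Rightarrow> 'a measure" where
  "empirical N \<xi> = distr (uniform_count_measure {..<N}) borel \<xi>"

definition M2 :: "'a::euclidean_space set \<Rightarrow> 'a measure set" where
  "M2 \<Xi> = {Q. prob_space Q \<and> sets Q = sets borel \<and> emeasure Q \<Xi> = 1 \<and>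
            (\<integral>\<^sup>+ \<xi>. ennreal ((norm \<xi>)\<^sup>2) \<partial>Q) < \<infinity>}"

definition couplings :: "'a::euclidean_space measure \<Rightarrow> 'a measure \<Rightarrow> ('a \<times> 'a) measure set" where
  "couplings Q1 Q2 = {\<pi>. sets \<pi> = sets (borel \<Otimes>\<^sub>M borel) \<and>
     distr \<pi> borel fst = Q1 \<and> distr \<pi> borel snd = Q2}"

definition ennreal_sqrt :: "ennreal \<Rightarrow> ennreal" where
  "ennreal_sqrt c = (if c = \<infinity> then \<infinity> else ennreal (sqrt (enn2real c)))"

definition wasserstein2 :: "'a::euclidean_space measure \<Rightarrow> 'a measure \<Rightarrow> ennreal" where
  "wasserstein2 Q1 Q2 =
     (INF \<pi>\<in>couplings Q1 Q2. ennreal_sqrt (\<integral>\<^sup>+ (\<xi>1, \<xi>2). ennreal ((norm (\<xi>1 - \<xi>2))\<^sup>2) \<partial>\<pi>))"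

definition wasserstein_ball :: "'a::euclidean_space set \<Rightarrow> real \<Rightarrow> 'a measure \<Rightarrow> 'a measure set" where
  "wasserstein_ball \<Xi> \<epsilon> P = {Q \<in> M2 \<Xi>. wasserstein2 Q P \<le> ennreal \<epsilon>}"

text \<open>Losses are extended real, because the suboptimality loss is \<open>\<infinity>\<close> at signals where the
  inner minimization is unbounded below.\<close>

definition CVaR :: "real \<Rightarrow> 'a measure \<Rightarrow> ('a \<Rightarrow> ereal) \<Rightarrow> ereal" where
  "CVaR \<alpha> Q l =
     (INF \<tau>::real. ereal \<tau> +
        ereal (1 / \<alpha>) * enn2ereal (\<integral>\<^sup>+ \<xi>. e2ennreal (max (l \<xi> - ereal \<tau>) 0) \<partial>Q))"

definition response_set ::
  "(real^'k) set \<Rightarrow> real^'n^'k \<Rightarrow> real^'m^'k \<Rightarrow> real^'k \<Rightarrow> real^'m \<Rightarrow> (real^'n) set" where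
  "response_set \<K> W H h s = {x. W *v x \<succeq>\<^bsub>\<K>\<^esub> (H *v s + h)}"

definition support_set ::
  "(real^'c) set \<Rightarrow> (real^'k) set \<Rightarrow> real^'m^'c \<Rightarrow> real^'c \<Rightarrow> real^'n^'k \<Rightarrow> real^'m^'k \<Rightarrow> real^'k
   \<Rightarrow> ((real^'m) \<times> (real^'n)) set" where
  "support_set \<C> \<K> C d W H h =
     {(s, x). C *v s \<succeq>\<^bsub>\<C>\<^esub> d \<and> W *v x \<succeq>\<^bsub>\<K>\<^esub> (H *v s + h)}"

definition has_slater_point ::
  "(real^'c) set \<Rightarrow> (real^'k) set \<Rightarrow> real^'m^'c \<Rightarrow> real^'c \<Rightarrow> real^'n^'k \<Rightarrow> real^'m^'k \<Rightarrow> real^'k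
   \<Rightarrow> bool" where
  "has_slater_point \<C> \<K> C d W H h \<longleftrightarrow>
     (\<exists>s x. C *v s - d \<in> interior \<C> \<and> W *v x - (H *v s + h) \<in> interior \<K>)"

text \<open>A parameter is a triple \<open>(Qxx, Qxs, q)\<close> with \<open>Qxs\<close> an \<open>n \<times> m\<close> matrix, i.e. \<open>real^'m^'n\<close>.\<close>

type_synonym ('m, 'n) param =
  "((real, 'n) vec, 'n) vec \<times> ((real, 'm) vec, 'n) vec \<times> (real, 'n) vec"

fun hypothesis :: "('m::finite, 'n::finite) param \<Rightarrow> real^'m \<Rightarrow> real^'n \<Rightarrow> real" where
  "hypothesis (Qxx, Qxs, q) s x = x \<bullet> (Qxx *v x) + x \<bullet> (Qxs *v s) + q \<bullet> x"

definition subopt_loss ::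
  "(real^'k) set \<Rightarrow> real^'n^'k \<Rightarrow> real^'m^'k \<Rightarrow> real^'k \<Rightarrow> ('m, 'n) param
   \<Rightarrow> (real^'m) \<times> (real^'n) \<Rightarrow> ereal" where
  "subopt_loss \<K> W H h \<theta> = (\<lambda>(s, x).
     ereal (hypothesis \<theta> s x) - (INF y\<in>response_set \<K> W H h s. ereal (hypothesis \<theta> s y)))"

definition search_space_a :: "('m::finite, 'n::finite) param set" where
  "search_space_a = {(Qxx, Qxs, q). psd (Qxx - mat 1)}"

definition search_space_b :: "('n::finite, 'n) param set" where
  "search_space_b = {(Qxx, Qxs, q). psd Qxx \<and> Qxs = mat 1}"

definition search_space_c ::
  "(('m::finite, 'n::finite) param \<Rightarrow> real) \<Rightarrow> ('m, 'n) param \<Rightarrow> real \<Rightarrow> ('m, 'n) param set" where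
  "search_space_c nrm \<theta>0 \<Gamma> = {(Qxx, Qxs, q). psd Qxx \<and> nrm ((Qxx, Qxs, q) - \<theta>0) \<le> \<Gamma>}"

definition worst_case_risk ::
  "(real^'c) set \<Rightarrow> (real^'k) set \<Rightarrow> real^'m^'c \<Rightarrow> real^'c \<Rightarrow> real^'n^'k \<Rightarrow> real^'m^'k \<Rightarrow> real^'k
   \<Rightarrow> real \<Rightarrow> real \<Rightarrow> nat \<Rightarrow> (nat \<Rightarrow> real^'m) \<Rightarrow> (nat \<Rightarrow> real^'n) \<Rightarrow> ('m, 'n) param \<Rightarrow> ereal" where
  "worst_case_risk \<C> \<K> C d W H h \<alpha> \<epsilon> N shat xhat \<theta> =
     (SUP Q \<in> wasserstein_ball (support_set \<C> \<K> C d W H h) \<epsilon> (empirical N (\<lambda>i. (shat i, xhat i))).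
        CVaR \<alpha> Q (subopt_loss \<K> W H h \<theta>))"

text \<open>Here \<open>(s, x)\<close> is a single training sample. The \<open>1 \<times> 1\<close> block type fixes the width of
  the last block column and the height of the last block row.\<close>

definition sample_constraints ::
  "(real^'c) set \<Rightarrow> (real^'k) set \<Rightarrow> real^'m^'c \<Rightarrow> real^'c \<Rightarrow> real^'n^'k \<Rightarrow> real^'m^'k \<Rightarrow> real^'k
   \<Rightarrow> real^'m \<Rightarrow> real^'n
   \<Rightarrow> ('m, 'n) param \<Rightarrow> real \<Rightarrow> real \<Rightarrow> real \<Rightarrow> real \<Rightarrow> real
   \<Rightarrow> real^'c \<Rightarrow> real^'c \<Rightarrow> real^'k \<Rightarrow> real^'k \<Rightarrow> real^'k
   \<Rightarrow> real^'m \<Rightarrow> real^'m \<Rightarrow> real^'n \<Rightarrow> real^'n \<Rightarrow> real^'n \<Rightarrow> bool" where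
  "sample_constraints \<C> \<K> C d W H h s x \<theta> lam \<tau> r \<rho>1 \<rho>2 \<phi>1 \<phi>2 \<mu>1 \<mu>2 \<gamma> \<chi>1 \<chi>2 \<zeta>1 \<eta>1 \<zeta>2 \<longleftrightarrow>
     (case \<theta> of (Qxx, Qxs, q) \<Rightarrow>
        \<phi>1 \<in> dual_cone \<C> \<and> \<phi>2 \<in> dual_cone \<C> \<and>
        \<mu>1 \<in> dual_cone \<K> \<and> \<mu>2 \<in> dual_cone \<K> \<and> \<gamma> \<in> dual_cone \<K> \<and>
        \<chi>1 = (1/2) *\<^sub>R (- (transpose C *v \<phi>1) + transpose H *v (\<mu>1 + \<gamma>) - (2 * lam) *\<^sub>R s) \<and>
        \<zeta>1 = (1/2) *\<^sub>R (- q - transpose W *v \<mu>1 - (2 * lam) *\<^sub>R x) \<and>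
        \<eta>1 = (1/2) *\<^sub>R (q - transpose W *v \<gamma>) \<and>
        \<rho>1 = \<tau> + r + lam * (x \<bullet> x + s \<bullet> s) + d \<bullet> \<phi>1 + h \<bullet> (\<mu>1 + \<gamma>) \<and>
        \<chi>2 = (1/2) *\<^sub>R (- (transpose C *v \<phi>2) + transpose H *v \<mu>2 - (2 * lam) *\<^sub>R s) \<and>
        \<zeta>2 = (1/2) *\<^sub>R (- (transpose W *v \<mu>2) - (2 * lam) *\<^sub>R x) \<and>
        \<rho>2 = r + lam * (x \<bullet> x + s \<bullet> s) + d \<bullet> \<phi>2 + h \<bullet> \<mu>2 \<and>
        psd ((mat lam ||| - (1/2) *\<^sub>R transpose Qxs ||| (1/2) *\<^sub>R transpose Qxs ||| columnvector \<chi>1)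
         === (- (1/2) *\<^sub>R Qxs ||| mat lam - Qxx ||| 0 ||| columnvector \<zeta>1)
         === ((1/2) *\<^sub>R Qxs ||| 0 ||| Qxx ||| columnvector \<eta>1)
         === (rowvector \<chi>1 ||| rowvector \<zeta>1 ||| rowvector \<eta>1 ||| (mat \<rho>1 :: real^1^1))) \<and>
        psd ((mat lam ||| 0 ||| columnvector \<chi>2)
         === (0 ||| mat lam ||| columnvector \<zeta>2)
         === (rowvector \<chi>2 ||| rowvector \<zeta>2 ||| (mat \<rho>2 :: real^1^1))))"

text \<open>Optimal value of the conic program in the remaining variables for a fixed parameter \<open>\<theta>\<close>;
  it is \<open>\<infinity>\<close> if these constraints are infeasible.\<close>

definition conic_value ::
  "(real^'c) set \<Rightarrow> (real^'k) set \<Rightarrow> real^'m^'c \<Rightarrow> real^'c \<Rightarrow> real^'n^'k \<Rightarrow> real^'m^'k \<Rightarrow> real^'k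
   \<Rightarrow> real \<Rightarrow> real \<Rightarrow> nat \<Rightarrow> (nat \<Rightarrow> real^'m) \<Rightarrow> (nat \<Rightarrow> real^'n) \<Rightarrow> ('m, 'n) param \<Rightarrow> ereal" where
  "conic_value \<C> \<K> C d W H h \<alpha> \<epsilon> N shat xhat \<theta> =
     Inf {ereal (\<tau> + 1 / \<alpha> * (\<epsilon>\<^sup>2 * lam + 1 / real N * (\<Sum>i<N. r i))) |
          \<tau> lam r \<rho>1 \<rho>2 \<phi>1 \<phi>2 \<mu>1 \<mu>2 \<gamma> \<chi>1 \<chi>2 \<zeta>1 \<eta>1 \<zeta>2.
          0 \<le> lam \<and>
          (\<forall>i<N. sample_constraints \<C> \<K> C d W H h (shat i) (xhat i) \<theta> lam \<tau>
             (r i) (\<rho>1 i) (\<rho>2 i) (\<phi>1 i) (\<phi>2 i) (\<mu>1 i) (\<mu>2 i) (\<gamma> i)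
             (\<chi>1 i) (\<chi>2 i) (\<zeta>1 i) (\<eta>1 i) (\<zeta>2 i))}"

definition safe_approximation :: "'p set \<Rightarrow> ('p \<Rightarrow> ereal) \<Rightarrow> ('p \<Rightarrow> ereal) \<Rightarrow> bool" where
  "safe_approximation \<Theta> risk bound \<longleftrightarrow> (\<forall>\<theta>\<in>\<Theta>. risk \<theta> \<le> bound \<theta>)"

end

(* Weak duality. Evaluating the first matrix inequality at (s, x, y, 1) with (s, x) in the support and
   y feasible for s, the terms linear in (s, x, y) combine with rho_i1 to the pairings of the multipliers
   with the constraint slacks. These pairings are nonnegative, so
   F(s, x) - F(s, y) - tau <= r_i + lambda |(s, x) - (s_i, x_i)|^2. The second inequality at (s, x, 1)
   likewise gives 0 <= r_i + lambda |(s, x) - (s_i, x_i)|^2. Integrating against couplings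
   of nearly optimal cost bounds the expected excess loss by epsilon^2 lambda plus the mean of the r_i. *)

theory Submission
  imports Defs
begin

section \<open>Block vectors and quadratic forms of block matrices\<close>

definition vjoin :: "real^'a \<Rightarrow> real^'b \<Rightarrow> real^('a + 'b)" where
  "vjoin u v = (\<chi> i. case i of Inl a \<Rightarrow> u $ a | Inr b \<Rightarrow> v $ b)"

lemma sum_UNIV_sum:
  fixes f :: "'a::finite + 'b::finite \<Rightarrow> real"
  shows "(\<Sum>i\<in>UNIV. f i) = (\<Sum>a\<in>UNIV. f (Inl a)) + (\<Sum>b\<in>UNIV. f (Inr b))"
  unfolding UNIV_Plus_UNIV[symmetric] by (subst sum.Plus) (simp_all add: comp_def)

lemma inner_vjoin: "vjoin u v \<bullet> vjoin u' v' = u \<bullet> u' + v \<bullet> v'"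
  by (simp add: inner_vec_def vjoin_def sum_UNIV_sum)

lemma hcat_mult_vjoin: "(A ||| B) *v vjoin u v = A *v u + B *v v"
  by (simp add: vec_eq_iff matrix_vector_mult_def hcat_def vjoin_def sum_UNIV_sum)

lemma vcat_mult: "(A === B) *v w = vjoin (A *v w) (B *v w)"
  by (auto simp: vec_eq_iff matrix_vector_mult_def vcat_def vjoin_def split: sum.split)

lemma columnvector_mult: "columnvector u *v w = ((w :: real^1) $ 1) *\<^sub>R (u :: real^'a)"
  by (simp add: vec_eq_iff matrix_vector_mult_def columnvector_def)

text \<open>The inner product with \<open>w\<close> is part of the statement because a bordering row
  only occurs inside a quadratic form, where it contributes a scalar.\<close>

lemma inner_rowvector_mult: "(w :: real^1) \<bullet> (rowvector u *v v) = (w $ 1) * (u \<bullet> (v :: real^'a))"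
  by (simp add: matrix_vector_mult_def rowvector_def inner_vec_def)

lemma mat_mult_vec: "mat c *v v = c *\<^sub>R (v :: real^'a)"
proof -
  have "mat c = c *\<^sub>R (mat 1 :: real^'a^'a)"
    by (simp add: vec_eq_iff mat_def)
  then show ?thesis
    by (simp add: scaleR_matrix_vector_assoc[symmetric])
qed

lemma uminus_mult_vec: "(- A) *v v = - (A *v (v :: real^'a))"
  by (simp add: vec_eq_iff matrix_vector_mult_def sum_negf)

lemmas block_form_simps = inner_vjoin hcat_mult_vjoin vcat_mult columnvector_mult
  inner_rowvector_mult mat_mult_vec uminus_mult_vec inner_add_right inner_add_left inner_diff_right inner_diff_left
  matrix_vector_mult_diff_rdistrib scaleR_matrix_vector_assoc[symmetric]
  inner_scaleR_left inner_scaleR_right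

text \<open>Simp turns \<open>transpose A *v v\<close> into \<open>v v* A\<close>; this rule then
  gives a block and its transposed partner the same bilinear term.\<close>

lemma inner_vector_matrix: "v \<bullet> (u v* A) = u \<bullet> (A *v (v :: real^'a))"
  by (metis dot_lmul_matrix inner_commute)

section \<open>Pointwise bounds on the support from the matrix inequalities\<close>

lemma norm_diff_Pair_sq:
  fixes s s0 :: "real^'m" and x x0 :: "real^'n"
  shows "(norm ((s, x) - (s0, x0)))\<^sup>2 =
    s \<bullet> s + s0 \<bullet> s0 - 2 * (s0 \<bullet> s) + (x \<bullet> x + x0 \<bullet> x0 - 2 * (x0 \<bullet> x))"
  unfolding power2_norm_eq_inner by (simp add: inner_diff_left inner_diff_right inner_commute)

lemma sample_loss_bound:
  assumes sc: "sample_constraints \<C> \<K> C d W H h s0 x0 \<theta> lam \<tau> r \<rho>1 \<rho>2 \<phi>1 \<phi>2 \<mu>1 \<mu>2 \<gamma> \<chi>1 \<chi>2 \<zeta>1 \<eta>1 \<zeta>2"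
    and sx: "(s, x) \<in> support_set \<C> \<K> C d W H h"
    and y: "y \<in> response_set \<K> W H h s"
  shows "hypothesis \<theta> s x - hypothesis \<theta> s y - \<tau> \<le> r + lam * (norm ((s, x) - (s0, x0)))\<^sup>2"
proof -
  obtain Qxx Qxs q where \<theta>: "\<theta> = (Qxx, Qxs, q)" by (cases \<theta>) auto
  note c = sc[unfolded sample_constraints_def \<theta> prod.case]
  \<comment> \<open>The last entry 1 homogenizes the form: the border \<open>\<chi>1\<close>,
    \<open>\<zeta>1\<close>, \<open>\<eta>1\<close> yields the terms linear in \<open>s\<close>,
    \<open>x\<close>, \<open>y\<close>, and the corner \<open>\<rho>1\<close> yields the
    constant.\<close>
  let ?v = "vjoin s (vjoin x (vjoin y (vec 1 :: real^1)))"
  have chi: "\<chi>1 \<bullet> s = (1/2) * (- (\<phi>1 \<bullet> (C *v s)) + (\<mu>1 + \<gamma>) \<bullet> (H *v s) - 2 * lam * (s0 \<bullet> s))"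
    using c by (simp add: inner_diff_left inner_add_left dot_lmul_matrix)
  have zeta: "\<zeta>1 \<bullet> x = (1/2) * (- (q \<bullet> x) - \<mu>1 \<bullet> (W *v x) - 2 * lam * (x0 \<bullet> x))"
    using c by (simp add: inner_diff_left inner_add_left dot_lmul_matrix)
  have eta: "\<eta>1 \<bullet> y = (1/2) * (q \<bullet> y - \<gamma> \<bullet> (W *v y))"
    using c by (simp add: inner_diff_left inner_add_left dot_lmul_matrix)
  have "0 \<le> ?v \<bullet> (((mat lam ||| - (1/2) *\<^sub>R transpose Qxs ||| (1/2) *\<^sub>R transpose Qxs ||| columnvector \<chi>1)
         === (- (1/2) *\<^sub>R Qxs ||| mat lam - Qxx ||| 0 ||| columnvector \<zeta>1)
         === ((1/2) *\<^sub>R Qxs ||| 0 ||| Qxx ||| columnvector \<eta>1)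
         === (rowvector \<chi>1 ||| rowvector \<zeta>1 ||| rowvector \<eta>1 ||| (mat \<rho>1 :: real^1^1))) *v ?v)"
    using c unfolding psd_def by blast
  also have "\<dots> = lam * (s \<bullet> s) + lam * (x \<bullet> x) - x \<bullet> (Qxx *v x) + y \<bullet> (Qxx *v y)
      - x \<bullet> (Qxs *v s) + y \<bullet> (Qxs *v s) + 2 * (\<chi>1 \<bullet> s) + 2 * (\<zeta>1 \<bullet> x) + 2 * (\<eta>1 \<bullet> y) + \<rho>1"
    by (simp add: block_form_simps inner_vector_matrix inner_commute[of s \<chi>1]
        inner_commute[of x \<zeta>1] inner_commute[of y \<eta>1]) (simp add: inner_vec_def)
  finally have form: "0 \<le> \<dots>" .
  have p1: "0 \<le> \<phi>1 \<bullet> (C *v s - d)" and p2: "0 \<le> \<mu>1 \<bullet> (W *v x - (H *v s + h))"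
    and p3: "0 \<le> \<gamma> \<bullet> (W *v y - (H *v s + h))"
    using c sx y by (auto simp: dual_cone_def support_set_def response_set_def cone_ge_def)
  have rho: "\<rho>1 = \<tau> + r + lam * (x0 \<bullet> x0 + s0 \<bullet> s0) + d \<bullet> \<phi>1 + h \<bullet> (\<mu>1 + \<gamma>)"
    using c by blast
  \<comment> \<open>After substitution the form is exactly the right-hand side minus the left-hand
    side of the claim, minus the three pairings in \<open>p1\<close>, \<open>p2\<close>,
    \<open>p3\<close>.\<close>
  show ?thesis
    using form p1 p2 p3 unfolding norm_diff_Pair_sq \<theta> hypothesis.simps chi zeta eta rho
    by (simp add: algebra_simps inner_diff_right inner_add_right inner_add_left inner_commute[of d] inner_commute[of h])
qed

text \<open>This is the zero branch of the positive part in CVaR: the second matrix has no block for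
  \<open>y\<close>, and its corner has no \<open>\<tau>\<close>. It also ensures that
  \<open>ennreal\<close> does not truncate the bound.\<close>

lemma sample_bound_nonneg:
  assumes sc: "sample_constraints \<C> \<K> C d W H h s0 x0 \<theta> lam \<tau> r \<rho>1 \<rho>2 \<phi>1 \<phi>2 \<mu>1 \<mu>2 \<gamma> \<chi>1 \<chi>2 \<zeta>1 \<eta>1 \<zeta>2"
    and sx: "(s, x) \<in> support_set \<C> \<K> C d W H h"
  shows "0 \<le> r + lam * (norm ((s, x) - (s0, x0)))\<^sup>2"
proof -
  obtain Qxx Qxs q where \<theta>: "\<theta> = (Qxx, Qxs, q)" by (cases \<theta>) auto
  note c = sc[unfolded sample_constraints_def \<theta> prod.case]
  let ?v = "vjoin s (vjoin x (vec 1 :: real^1))"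
  have chi: "\<chi>2 \<bullet> s = (1/2) * (- (\<phi>2 \<bullet> (C *v s)) + \<mu>2 \<bullet> (H *v s) - 2 * lam * (s0 \<bullet> s))"
    using c by (simp add: inner_diff_left inner_add_left dot_lmul_matrix)
  have zeta: "\<zeta>2 \<bullet> x = (1/2) * (- (\<mu>2 \<bullet> (W *v x)) - 2 * lam * (x0 \<bullet> x))"
    using c by (simp add: inner_diff_left inner_add_left dot_lmul_matrix)
  have "0 \<le> ?v \<bullet> (((mat lam ||| 0 ||| columnvector \<chi>2)
         === (0 ||| mat lam ||| columnvector \<zeta>2)
         === (rowvector \<chi>2 ||| rowvector \<zeta>2 ||| (mat \<rho>2 :: real^1^1))) *v ?v)"
    using c unfolding psd_def by blast
  also have "\<dots> = lam * (s \<bullet> s) + lam * (x \<bullet> x) + 2 * (\<chi>2 \<bullet> s) + 2 * (\<zeta>2 \<bullet> x) + \<rho>2"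
    by (simp add: block_form_simps inner_commute[of s \<chi>2]
        inner_commute[of x \<zeta>2]) (simp add: inner_vec_def)
  finally have form: "0 \<le> \<dots>" .
  have p1: "0 \<le> \<phi>2 \<bullet> (C *v s - d)" and p2: "0 \<le> \<mu>2 \<bullet> (W *v x - (H *v s + h))"
    using c sx by (auto simp: dual_cone_def support_set_def cone_ge_def)
  have rho: "\<rho>2 = r + lam * (x0 \<bullet> x0 + s0 \<bullet> s0) + d \<bullet> \<phi>2 + h \<bullet> \<mu>2"
    using c by blast
  show ?thesis
    using form p1 p2 unfolding norm_diff_Pair_sq chi zeta rho
    by (simp add: algebra_simps inner_diff_right inner_add_right inner_commute[of d] inner_commute[of h])
qed

text \<open>The bound of \<open>sample_loss_bound\<close> is uniform in \<open>y\<close>, so it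
  passes to the infimum; the maximum with 0 is covered by
  \<open>sample_bound_nonneg\<close>.\<close>

lemma sample_excess_loss_bound:
  assumes sc: "sample_constraints \<C> \<K> C d W H h s0 x0 \<theta> lam \<tau> r \<rho>1 \<rho>2 \<phi>1 \<phi>2 \<mu>1 \<mu>2 \<gamma> \<chi>1 \<chi>2 \<zeta>1 \<eta>1 \<zeta>2"
    and sx: "\<xi> \<in> support_set \<C> \<K> C d W H h"
  shows "max (subopt_loss \<K> W H h \<theta> \<xi> - ereal \<tau>) 0 \<le> ereal (r + lam * (norm (\<xi> - (s0, x0)))\<^sup>2)"
proof -
  obtain s x where \<xi>: "\<xi> = (s, x)" by force
  define B where "B = r + lam * (norm (\<xi> - (s0, x0)))\<^sup>2"
  define I where "I = (INF y\<in>response_set \<K> W H h s. ereal (hypothesis \<theta> s y))"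
  have "ereal (hypothesis \<theta> s x - \<tau> - B) \<le> I"
    unfolding I_def using sample_loss_bound[OF sc sx[unfolded \<xi>]]
    by (intro INF_greatest) (force simp: B_def \<xi>)
  \<comment> \<open>Since \<open>x\<close> is itself a feasible response, the infimum lies between
    two reals, which excludes the infinite cases of subtraction in \<open>ereal\<close>.\<close>
  moreover have "I \<le> ereal (hypothesis \<theta> s x)"
    unfolding I_def using sx by (intro INF_lower) (auto simp: \<xi> support_set_def response_set_def)
  ultimately have "ereal (hypothesis \<theta> s x) - I - ereal \<tau> \<le> ereal B"
    by (cases I) auto
  then show ?thesis
    using sample_bound_nonneg[OF sc sx[unfolded \<xi>]]
    by (simp add: B_def I_def \<xi> subopt_loss_def)
qed

section \<open>The empirical distribution\<close>

lemma measurable_uniform_count [measurable]: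
  "\<xi> \<in> measurable (uniform_count_measure {..<N}) (borel :: 'a::euclidean_space measure)"
  by (auto simp: measurable_def uniform_count_measure_def space_point_measure sets_point_measure)

lemma integral_empirical:
  fixes f :: "'a::euclidean_space \<Rightarrow> ennreal"
  assumes "1 \<le> N" and [measurable]: "f \<in> borel_measurable borel"
  shows "(\<integral>\<^sup>+ x. f x \<partial>empirical N \<xi>) = (\<Sum>i<N. f (\<xi> i)) / of_nat N"
proof -
  have "(\<integral>\<^sup>+ x. f x \<partial>empirical N \<xi>) = (\<integral>\<^sup>+ i. f (\<xi> i) \<partial>uniform_count_measure {..<N})"
    unfolding empirical_def by (rule nn_integral_distr) measurable
  also have "\<dots> = (\<Sum>i<N. f (\<xi> i) * ennreal (1 / real N))"
    unfolding uniform_count_measure_def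
    by (subst nn_integral_point_measure_finite) (auto simp: mult.commute)
  also have "\<dots> = (\<Sum>i<N. f (\<xi> i)) / of_nat N"
    using assms(1) by (simp add: sum_distrib_right[symmetric] divide_ennreal_def inverse_ennreal ennreal_of_nat_eq_real_of_nat
      inverse_eq_divide)
  finally show ?thesis .
qed

text \<open>Allows the second coordinate of a coupling to be replaced by a sample point almost
  everywhere. The finite image is closed, hence Borel.\<close>

lemma AE_empirical: "AE x in empirical N \<xi>. x \<in> \<xi> ` {..<N}"
proof -
  have [measurable]: "\<xi> ` {..<N} \<in> sets borel"
    by (intro borel_closed finite_imp_closed) simp
  show ?thesis
    unfolding empirical_def
    by (subst AE_distr_iff)
       (auto simp: uniform_count_measure_def space_point_measure intro!: AE_I2)
qed

section \<open>Integration along couplings and the Wasserstein ball\<close>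

text \<open>The loss need not be measurable, so the integral is estimated through simple functions below it.
  The constant \<open>R\<close> makes the possibly negative \<open>r i\<close> summable in \<^typ>\<open>ennreal\<close>.\<close>

lemma coupling_bound:
  fixes \<xi> :: "nat \<Rightarrow> 'a::euclidean_space"
  assumes N: "1 \<le> N" and \<pi>: "\<pi> \<in> couplings Q (empirical N \<xi>)"
    and Q: "prob_space Q" and \<Xi>: "AE x in Q. x \<in> \<Xi>" and lam: "0 \<le> lam"
    and cost: "(\<integral>\<^sup>+ (\<xi>1, \<xi>2). ennreal ((norm (\<xi>1 - \<xi>2))\<^sup>2) \<partial>\<pi>) \<le> ennreal c" and c: "0 \<le> c"
    and L: "\<And>i x. i < N \<Longrightarrow> x \<in> \<Xi> \<Longrightarrow> L x \<le> ennreal (r i + lam * (norm (x - \<xi> i))\<^sup>2)"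
    and nonneg: "\<And>i x. i < N \<Longrightarrow> x \<in> \<Xi> \<Longrightarrow> 0 \<le> r i + lam * (norm (x - \<xi> i))\<^sup>2"
  shows "0 \<le> lam * c + 1 / real N * (\<Sum>i<N. r i)"
    and "(\<integral>\<^sup>+ x. L x \<partial>Q) \<le> ennreal (lam * c + 1 / real N * (\<Sum>i<N. r i))"
proof -
  define avg where "avg = 1 / real N * (\<Sum>i<N. r i)"
  define R where "R = (\<Sum>i<N. \<bar>r i\<bar>)"
  have R: "0 \<le> R" by (simp add: R_def sum_nonneg)
  have Rr: "0 \<le> R + r i" if "i < N" for i
    using member_le_sum[of i "{..<N}" "\<lambda>i. \<bar>r i\<bar>"] that by (auto simp: R_def)
  \<comment> \<open>Samples may coincide, and then their bounds \<open>r i\<close> may still differ.\<close>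
  define m where "m z = Min (r ` {i. i < N \<and> \<xi> i = z})" for z
  \<comment> \<open>\<open>G\<close> is the shifted sample bound as a Borel function of the second
    coordinate. The sum runs over distinct sample points, so coinciding samples are not counted
    twice.\<close>
  define G where "G x = (\<Sum>z\<in>\<xi> ` {..<N}. ennreal (R + m z) * indicator {z} x)" for x
  have [measurable]: "G \<in> borel_measurable borel" unfolding G_def by measurable
  have G: "G (\<xi> i) = ennreal (R + m (\<xi> i))" if "i < N" for i
  proof -
    have "G (\<xi> i) = (\<Sum>z\<in>{\<xi> i}. ennreal (R + m z) * indicator {z} (\<xi> i))"
      unfolding G_def by (rule sum.mono_neutral_right) (use that in auto)
    then show ?thesis by simp
  qed
  \<comment> \<open>The minimum serves twice: it is at most every \<open>r i\<close>, which bounds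
    the mean of \<open>G\<close>, and it is attained, so \<open>G\<close> still comes from the bound
    of an actual index.\<close>
  have m_le: "m (\<xi> i) \<le> r i" if "i < N" for i
    unfolding m_def using that by (intro Min_le) auto
  have m_in: "\<exists>j<N. \<xi> j = \<xi> i \<and> m (\<xi> i) = r j" if "i < N" for i
  proof -
    have "m (\<xi> i) \<in> r ` {j. j < N \<and> \<xi> j = \<xi> i}"
      unfolding m_def by (rule Min_in) (use that in auto)
    then show ?thesis by auto
  qed
  have sets\<pi> [measurable_cong]: "sets \<pi> = sets (borel \<Otimes>\<^sub>M borel)"
    and fst\<pi>: "distr \<pi> borel fst = Q" and snd\<pi>: "distr \<pi> borel snd = empirical N \<xi>"
    using \<pi> by (auto simp: couplings_def)
  have "AE p in \<pi>. fst p \<in> \<Xi>"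
    by (rule AE_distrD[of fst \<pi> borel]) (measurable, simp only: fst\<pi> \<Xi>)
  moreover have "AE p in \<pi>. snd p \<in> \<xi> ` {..<N}"
    by (rule AE_distrD[of snd \<pi> borel]) (measurable, simp only: snd\<pi> AE_empirical)
  ultimately have AE: "AE p in \<pi>. fst p \<in> \<Xi> \<and> snd p \<in> \<xi> ` {..<N}"
    by simp
  have mean: "(\<Sum>i<N. R + r i) / real N = R + avg"
    using N by (simp add: avg_def sum.distrib field_simps)
  have Ravg: "0 \<le> R + avg"
    unfolding mean[symmetric] using Rr by (intro divide_nonneg_nonneg sum_nonneg) auto
  have "(\<integral>\<^sup>+ x. G x \<partial>empirical N \<xi>) \<le> (\<Sum>i<N. ennreal (R + r i)) / of_nat N"
    unfolding integral_empirical[OF N \<open>G \<in> borel_measurable borel\<close>]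
    by (intro divide_right_mono_ennreal sum_mono) (use m_le G in \<open>auto intro!: ennreal_leI\<close>)
  also have "\<dots> = ennreal ((\<Sum>i<N. R + r i) / real N)"
    using N by (subst sum_ennreal)
      (auto simp: Rr ennreal_of_nat_eq_real_of_nat intro!: divide_ennreal sum_nonneg)
  finally have intG: "(\<integral>\<^sup>+ x. G x \<partial>empirical N \<xi>) \<le> ennreal (R + avg)"
    unfolding mean .
  \<comment> \<open>\<open>R\<close> is added on both sides, so no subtraction in
    \<open>ennreal\<close> is needed. Measurability of \<open>g\<close> permits the change of
    variables to \<open>\<pi>\<close>.\<close>
  have simple: "(\<integral>\<^sup>+ x. g x \<partial>Q) + ennreal R \<le> ennreal (R + (lam * c + avg))"
    if g: "simple_function Q g" "g \<le> L" for g
  proof -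
    have setsQ: "sets Q = sets borel" using fst\<pi> by auto
    have [measurable]: "g \<in> borel_measurable borel"
      using borel_measurable_simple_function[OF g(1)] measurable_cong_sets[OF setsQ refl] by blast
    have "(\<integral>\<^sup>+ x. g x \<partial>Q) + ennreal R = (\<integral>\<^sup>+ x. g x + ennreal R \<partial>Q)"
      using Q setsQ by (subst nn_integral_add) (auto simp: prob_space.emeasure_space_1
          cong: measurable_cong_sets)
    also have "\<dots> = (\<integral>\<^sup>+ p. g (fst p) + ennreal R \<partial>\<pi>)"
      unfolding fst\<pi>[symmetric] by (subst nn_integral_distr) auto
    also have "\<dots> \<le> (\<integral>\<^sup>+ p. G (snd p) + ennreal lam * ennreal ((norm (fst p - snd p))\<^sup>2) \<partial>\<pi>)"
    proof (rule nn_integral_mono_AE, rule AE_mp[OF AE], rule AE_I2, intro impI, elim conjE)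
      fix p assume p: "fst p \<in> \<Xi>" "snd p \<in> \<xi> ` {..<N}"
      then obtain i where i: "i < N" "snd p = \<xi> i" by auto
      \<comment> \<open>The loss bound is applied at the index \<open>j\<close> attaining the
        minimum, because its value is the one stored in \<open>G\<close>.\<close>
      obtain j where j: "j < N" "\<xi> j = \<xi> i" "m (\<xi> i) = r j" using m_in[OF i(1)] by auto
      have "g (fst p) + ennreal R \<le> ennreal (r j + lam * (norm (fst p - \<xi> j))\<^sup>2) + ennreal R"
        using g(2) L[OF j(1) p(1)] by (auto simp: le_fun_def intro: add_right_mono order_trans)
      also have "\<dots> = ennreal (R + r j) + ennreal (lam * (norm (fst p - \<xi> j))\<^sup>2)"
        using nonneg[OF j(1) p(1)] R Rr[OF j(1)] lam
        by (simp add: ennreal_plus[symmetric] algebra_simps del: ennreal_plus)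
      finally show "g (fst p) + ennreal R \<le> G (snd p) + ennreal lam * ennreal ((norm (fst p - snd p))\<^sup>2)"
        using i j G[OF i(1)] lam by (simp add: ennreal_mult)
    qed
    \<comment> \<open>\<open>G\<close> sees only the second marginal, and the remaining term is the
      transport cost.\<close>
    also have "\<dots> = (\<integral>\<^sup>+ x. G x \<partial>empirical N \<xi>) +
        ennreal lam * (\<integral>\<^sup>+ (\<xi>1, \<xi>2). ennreal ((norm (\<xi>1 - \<xi>2))\<^sup>2) \<partial>\<pi>)"
      unfolding snd\<pi>[symmetric]
      by (subst nn_integral_add) (auto simp: nn_integral_distr nn_integral_cmult case_prod_unfold)
    also have "\<dots> \<le> ennreal (R + avg) + ennreal lam * ennreal c"
      by (intro add_mono mult_left_mono intG cost) auto
    also have "\<dots> = ennreal (R + (lam * c + avg))"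
      using lam c Ravg by (simp add: ennreal_mult[symmetric] ennreal_plus[symmetric] algebra_simps del: ennreal_plus)
    finally show ?thesis .
  qed
  \<comment> \<open>The zero function is simple and lies below \<open>L\<close>. Comparing with it
    shows that the total bound is nonnegative even if the mean of the \<open>r i\<close> is
    negative.\<close>
  have "ennreal R \<le> ennreal (R + (lam * c + avg))"
    using simple[of "\<lambda>_. 0"] by (simp add: le_fun_def)
  then show nn: "0 \<le> lam * c + 1 / real N * (\<Sum>i<N. r i)"
    unfolding avg_def[symmetric] using lam c Ravg R
    using mult_nonneg_nonneg[OF lam c] by (subst (asm) ennreal_le_iff) linarith+
  show "(\<integral>\<^sup>+ x. L x \<partial>Q) \<le> ennreal (lam * c + 1 / real N * (\<Sum>i<N. r i))"
    unfolding nn_integral_def avg_def[symmetric]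
  proof (rule SUP_least)
    fix g assume "g \<in> {g. simple_function Q g \<and> g \<le> L}"
    then have g: "simple_function Q g" "g \<le> L" by auto
    \<comment> \<open>By \<open>nn\<close>, \<open>ennreal\<close> splits over the sum, and the
      finite \<open>R\<close> can be cancelled.\<close>
    have "(\<integral>\<^sup>+ x. g x \<partial>Q) + ennreal R \<le> ennreal (lam * c + avg) + ennreal R"
      using simple[OF g] nn R by (simp add: avg_def add.commute)
    then show "integral\<^sup>S Q g \<le> ennreal (lam * c + avg)"
      using nn_integral_eq_simple_integral[OF g(1)] by (simp add: ennreal_add_left_cancel_le add.commute[of _ "ennreal R"])
  qed
qed

text \<open>Every \<open>e\<close> above \<open>\<epsilon>\<close> admits a coupling of cost at most
  the square of \<open>e\<close>, so no optimal coupling has to be produced; then \<open>e\<close>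
  decreases to \<open>\<epsilon>\<close>. The conclusion is in \<open>ereal\<close> so that a
  negative right-hand side is not truncated to 0.\<close>

lemma wasserstein_ball_bound:
  fixes \<xi> :: "nat \<Rightarrow> 'a::euclidean_space"
  assumes N: "1 \<le> N" and Q: "Q \<in> wasserstein_ball \<Xi> \<epsilon> (empirical N \<xi>)"
    and \<epsilon>: "0 \<le> \<epsilon>" and lam: "0 \<le> lam"
    and L: "\<And>i x. i < N \<Longrightarrow> x \<in> \<Xi> \<Longrightarrow> L x \<le> ennreal (r i + lam * (norm (x - \<xi> i))\<^sup>2)"
    and nonneg: "\<And>i x. i < N \<Longrightarrow> x \<in> \<Xi> \<Longrightarrow> 0 \<le> r i + lam * (norm (x - \<xi> i))\<^sup>2"
  shows "enn2ereal (\<integral>\<^sup>+ x. L x \<partial>Q) \<le> ereal (\<epsilon>\<^sup>2 * lam + 1 / real N * (\<Sum>i<N. r i))"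
proof -
  define avg where "avg = 1 / real N * (\<Sum>i<N. r i)"
  have prob: "prob_space Q" and Q1: "emeasure Q \<Xi> = 1" and dist: "wasserstein2 Q (empirical N \<xi>) \<le> ennreal \<epsilon>"
    using Q by (auto simp: wasserstein_ball_def M2_def)
  interpret prob_space Q by (fact prob)
  have AE: "AE x in Q. x \<in> \<Xi>"
    \<comment> \<open>Nonmeasurable sets have \<open>emeasure\<close> 0, so mass 1 makes the support
      measurable.\<close>
    using Q1 emeasure_neq_0_sets[of Q \<Xi>] by (subst AE_in_set_eq_1) (auto simp: measure_def)
  have bound: "0 \<le> e\<^sup>2 * lam + avg \<and> (\<integral>\<^sup>+ x. L x \<partial>Q) \<le> ennreal (e\<^sup>2 * lam + avg)" if e: "\<epsilon> < e" for e
  proof -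
    have "wasserstein2 Q (empirical N \<xi>) < ennreal e"
      using dist e \<epsilon> by (auto intro: le_less_trans simp: ennreal_less_iff)
    then obtain \<pi> where \<pi>: "\<pi> \<in> couplings Q (empirical N \<xi>)"
      and less: "ennreal_sqrt (\<integral>\<^sup>+ (\<xi>1, \<xi>2). ennreal ((norm (\<xi>1 - \<xi>2))\<^sup>2) \<partial>\<pi>) < ennreal e"
      unfolding wasserstein2_def INF_less_iff by blast
    define k where "k = (\<integral>\<^sup>+ (\<xi>1, \<xi>2). ennreal ((norm (\<xi>1 - \<xi>2))\<^sup>2) \<partial>\<pi>)"
    have k: "k \<le> ennreal (e\<^sup>2)"
    proof (cases k)
      case (real t)
      then have "sqrt t < e" using less e \<epsilon> by (auto simp: k_def[symmetric] ennreal_sqrt_def ennreal_less_iff)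
      then have "t \<le> e\<^sup>2" using real sqrt_le_D by (auto intro: less_imp_le)
      then show ?thesis using real by (auto intro: ennreal_leI)
    next
      case top
      then show ?thesis using less by (simp add: k_def[symmetric] ennreal_sqrt_def)
    qed
    show ?thesis
      using coupling_bound[OF N \<pi> prob AE lam k[unfolded k_def] _ L nonneg]
      by (simp add: avg_def mult.commute)
  qed
  \<comment> \<open>Any radius above \<open>\<epsilon>\<close> would do; one such bound makes the
    integral finite.\<close>
  obtain t where t: "0 \<le> t" "(\<integral>\<^sup>+ x. L x \<partial>Q) = ennreal t"
    using bound[of "\<epsilon> + 1"] by (cases "\<integral>\<^sup>+ x. L x \<partial>Q") (auto simp: top_unique)
  have "t \<le> \<epsilon>\<^sup>2 * lam + avg"
  proof (rule tendsto_lowerbound)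
    show "((\<lambda>e. e\<^sup>2 * lam + avg) \<longlongrightarrow> \<epsilon>\<^sup>2 * lam + avg) (at_right \<epsilon>)"
      by (intro tendsto_intros)
    show "\<forall>\<^sub>F e in at_right \<epsilon>. t \<le> e\<^sup>2 * lam + avg"
      using eventually_at_right_less[of \<epsilon>] by eventually_elim (use bound t in \<open>metis ennreal_le_iff\<close>)
  qed simp
  then show ?thesis using t by (simp add: avg_def)
qed

section \<open>From the expected excess loss to the worst-case risk\<close>

lemma safe_approximation_conic_value:
  assumes \<alpha>: "0 < \<alpha>" and \<epsilon>: "0 \<le> \<epsilon>" and N: "1 \<le> N"
  shows "safe_approximation \<Theta> (worst_case_risk \<C> \<K> C d W H h \<alpha> \<epsilon> N shat xhat)
           (conic_value \<C> \<K> C d W H h \<alpha> \<epsilon> N shat xhat)"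
  unfolding safe_approximation_def worst_case_risk_def conic_value_def
\<comment> \<open>It suffices to compare each distribution in the ball with each feasible point; an
  infeasible program has value \<infinity> and leaves nothing to check.\<close>
proof (intro ballI SUP_least Inf_greatest, elim CollectE exE conjE)
  fix \<theta> Q v \<tau> lam r \<rho>1 \<rho>2 \<phi>1 \<phi>2 \<mu>1 \<mu>2 \<gamma> \<chi>1 \<chi>2 \<zeta>1 \<eta>1 \<zeta>2
  assume Q: "Q \<in> wasserstein_ball (support_set \<C> \<K> C d W H h) \<epsilon> (empirical N (\<lambda>i. (shat i, xhat i)))"
    and v: "v = ereal (\<tau> + 1 / \<alpha> * (\<epsilon>\<^sup>2 * lam + 1 / real N * (\<Sum>i<N. r i)))" and lam: "0 \<le> lam"
    and sc: "\<forall>i<N. sample_constraints \<C> \<K> C d W H h (shat i) (xhat i) \<theta> lam \<tau>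
             (r i) (\<rho>1 i) (\<rho>2 i) (\<phi>1 i) (\<phi>2 i) (\<mu>1 i) (\<mu>2 i) (\<gamma> i)
             (\<chi>1 i) (\<chi>2 i) (\<zeta>1 i) (\<eta>1 i) (\<zeta>2 i)"
  let ?l = "subopt_loss \<K> W H h \<theta>"
  let ?I = "\<integral>\<^sup>+ \<xi>. e2ennreal (max (?l \<xi> - ereal \<tau>) 0) \<partial>Q"
  \<comment> \<open>The \<open>\<tau>\<close> of the feasible point is a candidate in the infimum
    defining CVaR.\<close>
  have "CVaR \<alpha> Q ?l \<le> ereal \<tau> + ereal (1 / \<alpha>) * enn2ereal ?I"
    unfolding CVaR_def by (rule INF_lower) simp
  also have "\<dots> \<le> ereal \<tau> + ereal (1 / \<alpha>) * ereal (\<epsilon>\<^sup>2 * lam + 1 / real N * (\<Sum>i<N. r i))"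
  proof (intro add_left_mono ereal_mult_left_mono wasserstein_ball_bound[OF N Q \<epsilon> lam])
    fix i \<xi> assume i: "i < N" "\<xi> \<in> support_set \<C> \<K> C d W H h"
    note b = sample_excess_loss_bound[OF sc[rule_format, OF i(1)] i(2)]
    show "e2ennreal (max (?l \<xi> - ereal \<tau>) 0) \<le> ennreal (r i + lam * (norm (\<xi> - (shat i, xhat i)))\<^sup>2)"
      using e2ennreal_mono[OF b] by simp
    show "0 \<le> r i + lam * (norm (\<xi> - (shat i, xhat i)))\<^sup>2"
      using b by simp
  qed (use \<alpha> in auto)
  finally show "CVaR \<alpha> Q ?l \<le> v" by (simp add: v)
qed

text \<open>Search space (b) has its own conjunct because \<open>Qxs = mat 1\<close> forces signals
  and responses to have the same dimension, which changes the types of \<open>C\<close>,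
  \<open>H\<close> and \<open>shat\<close>.\<close>

theorem theorem6p3:
  fixes \<C> :: "(real^'c) set" and \<K> :: "(real^'k) set"
    and d :: "real^'c" and W :: "real^'n^'k" and h :: "real^'k"
    and \<alpha> \<epsilon> :: real and N :: nat and xhat :: "nat \<Rightarrow> real^'n"
  assumes "proper_cone \<C>" and "proper_cone \<K>"
    and "0 < \<alpha>" and "\<alpha> \<le> 1" and "0 \<le> \<epsilon>" and "1 \<le> N"
  shows
    "(\<forall>(C :: real^'m^'c) (H :: real^'m^'k) (shat :: nat \<Rightarrow> real^'m).
        has_slater_point \<C> \<K> C d W H h \<longrightarrow>
          safe_approximation search_space_a
            (worst_case_risk \<C> \<K> C d W H h \<alpha> \<epsilon> N shat xhat)
            (conic_value \<C> \<K> C d W H h \<alpha> \<epsilon> N shat xhat) \<and>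
          (\<forall>nrm \<theta>0 \<Gamma>. is_norm nrm \<longrightarrow>
             safe_approximation (search_space_c nrm \<theta>0 \<Gamma>)
               (worst_case_risk \<C> \<K> C d W H h \<alpha> \<epsilon> N shat xhat)
               (conic_value \<C> \<K> C d W H h \<alpha> \<epsilon> N shat xhat))) \<and>
     (\<forall>(C :: real^'n^'c) (H :: real^'n^'k) (shat :: nat \<Rightarrow> real^'n).
        has_slater_point \<C> \<K> C d W H h \<longrightarrow>
          safe_approximation search_space_b
            (worst_case_risk \<C> \<K> C d W H h \<alpha> \<epsilon> N shat xhat)
            (conic_value \<C> \<K> C d W H h \<alpha> \<epsilon> N shat xhat))"
  using assms by (simp add: safe_approximation_conic_value)

end
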